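(* Let $t>0$ be fixed. If $$\sum_{n\ge 0}\mathbb E\Big[\Big(\prod_{j=0}^n\kappa(X_j)\Big)\mathbf 1_{\{S_n\le t\}}\Big]<\infty,$$ then $\mathbb E(N_t)<\infty$ and $$\mathbb E(N_t)=1+\sum_{n\ge 0}\mathbb E\Big[\Big(\prod_{j=0}^{n-1}\kappa(X_j)\Big)\big(\kappa(X_n)-1\big)\mathbf 1_{\{S_n\le t\}}\Big],$$ with the convention $\prod_{j=0}^{-1}\kappa(X_j)=1$.
   Context: Branching model. $(\mathbb X,\mathcal X)$ is a measurable space, $\xi:\mathbb X\to[0,+\infty)$ and $\kappa:\mathbb X\to\{2,3,\dots\}$ are measurable functions, and $(X_n)_{n\ge 0}$ is an $\mathbb X$-valued process. Cells are labelled by finite sequences $v=(k_1,\dots,k_n)$ of positive integers ($n$ is the generation of $v$; the empty sequence labels the single initial cell, born at time $0$). To each label $v$ is attached an $\mathbb X$-valued random variable $X_v$ (its parameter) in such a way that, along every infinite line of descent $(v_n)_{n\ge0}$ ($v_0=\emptyset$ and $v_{n+1}$ is obtained from $v_n$ by appending one positive integer), the process $(X_{v_n})_{n\ge 0}$ has the same law as $(X_n)_{n\ge 0}$ (parameters on different lines need not be independent). A cell $v$ has lifetime $\xi(X_v)$ and at the end of its lifetime it splits into $\kappa(X_v)$ new cells, labelled by appending $1,\dots,\kappa(X_v)$ to $v$. Thus $v=(k_1,\dots,k_n)$ actually occurs iff $k_{i+1}\le\kappa(X_{(k_1,\dots,k_i)})$ for $0\le i<n$, and it is then alive at time $t$ iff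 $\sum_{i=0}^{n-1}\xi(X_{(k_1,\dots,k_i)})\le t<\sum_{i=0}^{n}\xi(X_{(k_1,\dots,k_i)})$. $N_t$ is the number of cells alive at time $t$. Finally $S_n:=\sum_{k=0}^n\xi(X_k)$. *)

theory Defs
  imports "HOL-Probability.Probability"
begin

text \<open>
  Labels are lists of positive natural numbers, the empty list being the initial cell.
  The line process \<open>X\<close> and the family \<open>Y\<close> of parameters may live on different
  probability spaces \<open>P\<close> and \<open>M\<close>, since they are only related through their laws.
\<close>

definition labels :: "nat list set" where
  "labels = {v. \<forall>k\<in>set v. 1 \<le> k}"

definition line_of_descent :: "(nat \<Rightarrow> nat list) \<Rightarrow> bool" where
  "line_of_descent v \<longleftrightarrow> v 0 = [] \<and> (\<forall>n. \<exists>k\<ge>1. v (Suc n) = v n @ [k])"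

locale branching_model =
  P: prob_space P + M: prob_space M
  for P :: "'p measure" and M :: "'w measure" +
  fixes E :: "'x measure"
    and \<xi> :: "'x \<Rightarrow> real"
    and \<kappa> :: "'x \<Rightarrow> nat"
    and X :: "nat \<Rightarrow> 'p \<Rightarrow> 'x"
    and Y :: "nat list \<Rightarrow> 'w \<Rightarrow> 'x"
  assumes lifetime_measurable: "\<xi> \<in> borel_measurable E"
    and lifetime_nonneg: "\<And>x. x \<in> space E \<Longrightarrow> 0 \<le> \<xi> x"
    and offspring_measurable: "\<kappa> \<in> measurable E (count_space UNIV)"
    and offspring_ge_2: "\<And>x. x \<in> space E \<Longrightarrow> 2 \<le> \<kappa> x"
    and process_measurable: "\<And>n. X n \<in> measurable P E"
    and parameter_measurable: "\<And>v. v \<in> labels \<Longrightarrow> Y v \<in> measurable M E"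
    and line_law: "\<And>v. line_of_descent v \<Longrightarrow>
      distr M (\<Pi>\<^sub>M n\<in>UNIV. E) (\<lambda>\<omega> n. Y (v n) \<omega>) =
      distr P (\<Pi>\<^sub>M n\<in>UNIV. E) (\<lambda>\<omega> n. X n \<omega>)"

definition partial_sum :: "('x \<Rightarrow> real) \<Rightarrow> (nat \<Rightarrow> 'p \<Rightarrow> 'x) \<Rightarrow> nat \<Rightarrow> 'p \<Rightarrow> real" where
  "partial_sum \<xi> X n \<omega> = (\<Sum>k\<le>n. \<xi> (X k \<omega>))"

text \<open>
  For \<open>v = (k\<^sub>1, \<dots>, k\<^sub>n)\<close>, \<open>take i v\<close> is the ancestor \<open>(k\<^sub>1, \<dots>, k\<^sub>i)\<close> and
  \<open>v ! i\<close> is \<open>k\<^sub>i\<^sub>+\<^sub>1\<close>.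
\<close>

definition occurs :: "('x \<Rightarrow> nat) \<Rightarrow> (nat list \<Rightarrow> 'w \<Rightarrow> 'x) \<Rightarrow> 'w \<Rightarrow> nat list \<Rightarrow> bool" where
  "occurs \<kappa> Y \<omega> v \<longleftrightarrow> (\<forall>i<length v. v ! i \<le> \<kappa> (Y (take i v) \<omega>))"

definition alive ::
  "('x \<Rightarrow> real) \<Rightarrow> ('x \<Rightarrow> nat) \<Rightarrow> (nat list \<Rightarrow> 'w \<Rightarrow> 'x) \<Rightarrow> real \<Rightarrow> 'w \<Rightarrow> nat list \<Rightarrow> bool" where
  "alive \<xi> \<kappa> Y t \<omega> v \<longleftrightarrow> v \<in> labels \<and> occurs \<kappa> Y \<omega> v \<and>
     (\<Sum>i<length v. \<xi> (Y (take i v) \<omega>)) \<le> t \<and>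
     t < (\<Sum>i\<le>length v. \<xi> (Y (take i v) \<omega>))"

text \<open>The counting measure is used, not \<open>card\<close>, because there may be infinitely many cells.\<close>

definition num_alive ::
  "('x \<Rightarrow> real) \<Rightarrow> ('x \<Rightarrow> nat) \<Rightarrow> (nat list \<Rightarrow> 'w \<Rightarrow> 'x) \<Rightarrow> real \<Rightarrow> 'w \<Rightarrow> ennreal" where
  "num_alive \<xi> \<kappa> Y t \<omega> = emeasure (count_space UNIV) {v. alive \<xi> \<kappa> Y t \<omega> v}"

text \<open>
  \<open>num_alive\<close> is a random variable, so its \<open>nn_integral\<close> is an expectation in \<open>[0, \<infinity>]\<close>.
\<close>

lemma (in branching_model) num_alive_measurable: "num_alive \<xi> \<kappa> Y t \<in> borel_measurable M"
proof -
  have lab: "take i v \<in> labels" if "v \<in> labels" for i v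
    using that set_take_subset[of i v] by (auto simp: labels_def)
  have lif: "(\<lambda>\<omega>. \<xi> (Y (take i v) \<omega>)) \<in> borel_measurable M" if "v \<in> labels" for i v
    using measurable_compose[OF parameter_measurable[OF lab[OF that]] lifetime_measurable] .
  have off: "(\<lambda>\<omega>. \<kappa> (Y (take i v) \<omega>)) \<in> measurable M (count_space UNIV)" if "v \<in> labels" for i v
    using measurable_compose[OF parameter_measurable[OF lab[OF that]] offspring_measurable] .
  have al: "Measurable.pred M (\<lambda>\<omega>. alive \<xi> \<kappa> Y t \<omega> v)" for v
  proof (cases "v \<in> labels")
    case True
    note [measurable] = lif[OF True] off[OF True]
    show ?thesis
      unfolding alive_def occurs_def by measurable
  next
    case False
    then show ?thesis by (simp add: alive_def)
  qed
  have "num_alive \<xi> \<kappa> Y t \<omega> = (\<integral>\<^sup>+v. (if alive \<xi> \<kappa> Y t \<omega> v then 1 else 0) \<partial>count_space UNIV)" for \<omega>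
  proof -
    have "num_alive \<xi> \<kappa> Y t \<omega> = (\<integral>\<^sup>+v. indicator {v. alive \<xi> \<kappa> Y t \<omega> v} v \<partial>count_space UNIV)"
      unfolding num_alive_def by (rule nn_integral_indicator[symmetric]) simp
    also have "\<dots> = (\<integral>\<^sup>+v. (if alive \<xi> \<kappa> Y t \<omega> v then 1 else 0) \<partial>count_space UNIV)"
      by (intro nn_integral_cong) (simp add: indicator_def)
    finally show ?thesis .
  qed
  moreover have "(\<integral>\<^sup>+v. (if alive \<xi> \<kappa> Y t \<omega> v then 1 else 0) \<partial>count_space UNIV) =
      (\<Sum>n. if alive \<xi> \<kappa> Y t \<omega> (from_nat_into UNIV n) then 1 else (0::ennreal))" for \<omega>
    unfolding nn_integral_count_space_nat[symmetric]
    by (rule nn_integral_bij_count_space[symmetric, OF bij_betw_from_nat_into])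
      (auto simp: infinite_UNIV_listI)
  ultimately have eq: "num_alive \<xi> \<kappa> Y t =
      (\<lambda>\<omega>. \<Sum>n. if alive \<xi> \<kappa> Y t \<omega> (from_nat_into UNIV n) then 1 else 0)"
    by (intro ext) simp
  note [measurable] = al
  show ?thesis unfolding eq by measurable
qed

end

theory Submission
  imports Defs
begin

text \<open>
  Every label of generation \<open>n\<close> lies on a line of descent, so the probability that its cell is
  alive can be computed with the process \<open>X\<close> in place of the parameters along that line. The
  expected number of cells alive is therefore the same as in the model where all cells of
  generation \<open>n\<close> share the parameter \<open>X\<^sub>n\<close>, and there the cells of generation \<open>n\<close> number exactly
  \<open>\<kappa>(X\<^sub>0) \<cdots> \<kappa>(X\<^sub>n\<^sub>-\<^sub>1)\<close> and are alive iff \<open>S\<^sub>n\<^sub>-\<^sub>1 \<le> t < S\<^sub>n\<close>. Writing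
  \<open>1{S\<^sub>n\<^sub>-\<^sub>1 \<le> t < S\<^sub>n} = 1{S\<^sub>n\<^sub>-\<^sub>1 \<le> t} - 1{S\<^sub>n \<le> t}\<close> and summing by parts gives the formula.
\<close>

text \<open>The bound on each entry depends only on its position, so the last entry can be chosen
  independently of the others and contributes a factor \<open>b n\<close>. Finiteness is recorded
  because the counting measure agrees with \<open>card\<close> only on finite sets.\<close>

lemma card_bounded_labels:
  fixes b :: "nat \<Rightarrow> nat"
  shows "finite {v \<in> labels. length v = n \<and> (\<forall>i<n. v ! i \<le> b i)} \<and>
    card {v \<in> labels. length v = n \<and> (\<forall>i<n. v ! i \<le> b i)} = (\<Prod>i<n. b i)"
proof (induction n)
  case 0
  have "{v \<in> labels. length v = 0 \<and> (\<forall>i<0. v ! i \<le> b i)} = {[]}"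
    by (auto simp: labels_def)
  then show ?case by simp
next
  case (Suc n)
  let ?A = "\<lambda>n. {v \<in> labels. length v = n \<and> (\<forall>i<n. v ! i \<le> b i)}"
  let ?f = "\<lambda>(v, k). v @ [k] :: nat list"
  have "?A (Suc n) = ?f ` (?A n \<times> {1..b n})"
  proof (intro equalityI subsetI)
    fix v assume v: "v \<in> ?A (Suc n)"
    then obtain w k where w: "v = w @ [k]"
      by (cases v rule: rev_cases) auto
    have len: "length w = n" and lab: "w \<in> labels" "1 \<le> k"
      using v w by (auto simp: labels_def)
    have bd: "(w @ [k]) ! i \<le> b i" if "i < Suc n" for i
      using v w that by blast
    have "w ! i \<le> b i" if "i < n" for i
      using bd[of i] that len by (simp add: nth_append)
    moreover have "k \<le> b n"
      using bd[of n] len by (simp add: nth_append)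
    ultimately show "v \<in> ?f ` (?A n \<times> {1..b n})"
      using w len lab by auto
  qed (auto simp: labels_def nth_append less_Suc_eq)
  moreover have "inj_on ?f (?A n \<times> {1..b n})"
    by (auto simp: inj_on_def)
  ultimately show ?case
    using Suc.IH by (simp add: card_image card_cartesian_product)
qed

text \<open>Needed because \<open>line_law\<close> speaks of infinite lines only, while a cell is a
  finite label.\<close>

lemma line_of_descent_through:
  assumes "v \<in> labels"
  obtains l where "line_of_descent l" and "\<And>i. i \<le> length v \<Longrightarrow> l i = take i v"
proof
  \<comment> \<open>Follow the prefixes of \<open>v\<close>, then the first child forever; truncated
    subtraction keeps the padding empty up to \<open>length v\<close>.\<close>
  let ?l = "\<lambda>n. take n v @ replicate (n - length v) 1"
  have "\<exists>k\<ge>1. ?l (Suc n) = ?l n @ [k]" for n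
  proof (cases "n < length v")
    case True
    then show ?thesis
      using assms by (auto simp: take_Suc_conv_app_nth labels_def)
  next
    case False
    then show ?thesis
      by (auto simp: Suc_diff_le replicate_append_same)
  qed
  then show "line_of_descent ?l"
    by (simp add: line_of_descent_def)
  show "?l i = take i v" if "i \<le> length v" for i
    using that by simp
qed

lemma line_of_descent_nth:
  assumes "line_of_descent l"
  shows "length (l n) = n \<and> l n \<in> labels"
proof (induction n)
  case 0
  show ?case using assms by (simp add: line_of_descent_def labels_def)
next
  case (Suc n)
  obtain k where "k \<ge> 1" "l (Suc n) = l n @ [k]"
    using assms by (metis line_of_descent_def)
  then show ?case using Suc.IH by (simp add: labels_def)
qed

text \<open>Occurrence and both lifetime sums read parameters of \<open>v\<close> and its ancestors
  only. The two sample points may come from different spaces, so one of them can be a path.\<close>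

lemma alive_cong:
  assumes "\<And>i. i \<le> length v \<Longrightarrow> Y (take i v) \<omega> = Y' (take i v) \<omega>'"
  shows "alive \<xi> \<kappa> Y t \<omega> v \<longleftrightarrow> alive \<xi> \<kappa> Y' t \<omega>' v"
proof -
  have "(\<Sum>i<length v. \<xi> (Y (take i v) \<omega>)) = (\<Sum>i<length v. \<xi> (Y' (take i v) \<omega>'))"
    "(\<Sum>i\<le>length v. \<xi> (Y (take i v) \<omega>)) = (\<Sum>i\<le>length v. \<xi> (Y' (take i v) \<omega>'))"
    using assms by (auto intro!: sum.cong)
  moreover have "occurs \<kappa> Y \<omega> v \<longleftrightarrow> occurs \<kappa> Y' \<omega>' v"
    unfolding occurs_def using assms by auto
  ultimately show ?thesis
    by (simp add: alive_def)
qed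

text \<open>With one parameter per generation, all cells of generation \<open>n\<close> share the
  same birth and splitting times, so those that occur are alive all together or not at all.\<close>

lemma num_alive_generation_parameters:
  fixes X :: "nat \<Rightarrow> 'p \<Rightarrow> 'x"
  shows "num_alive \<xi> \<kappa> (\<lambda>v. X (length v)) t \<omega> =
    (\<Sum>n. of_nat (\<Prod>j<n. \<kappa> (X j \<omega>)) *
      indicator {\<omega>. (\<Sum>k<n. \<xi> (X k \<omega>)) \<le> t \<and> t < partial_sum \<xi> X n \<omega>} \<omega>)"
proof -
  let ?Y = "\<lambda>v. X (length v)"
  let ?B = "\<lambda>n. {v \<in> labels. length v = n \<and> (\<forall>i<n. v ! i \<le> \<kappa> (X i \<omega>))}"
  let ?C = "\<lambda>n. (\<Sum>k<n. \<xi> (X k \<omega>)) \<le> t \<and> t < partial_sum \<xi> X n \<omega>"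
  let ?A = "\<lambda>n. {v. alive \<xi> \<kappa> ?Y t \<omega> v \<and> length v = n}"
  have sums: "(\<Sum>i<length v. \<xi> (?Y (take i v) \<omega>)) = (\<Sum>k<length v. \<xi> (X k \<omega>))"
    "(\<Sum>i\<le>length v. \<xi> (?Y (take i v) \<omega>)) = partial_sum \<xi> X (length v) \<omega>" for v :: "nat list"
    by (auto simp: partial_sum_def intro!: sum.cong)
  have A: "?A n = (if ?C n then ?B n else {})" for n
    unfolding alive_def sums by (auto simp: occurs_def)
  have "emeasure (count_space UNIV) (?A n) =
      of_nat (\<Prod>j<n. \<kappa> (X j \<omega>)) *
      indicator {\<omega>. (\<Sum>k<n. \<xi> (X k \<omega>)) \<le> t \<and> t < partial_sum \<xi> X n \<omega>} \<omega>" for n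
    unfolding A using card_bounded_labels[of n "\<lambda>i. \<kappa> (X i \<omega>)"]
    by (simp add: indicator_def del: of_nat_prod)
  \<comment> \<open>Sort the living cells by generation and use countable additivity of the counting
    measure.\<close>
  moreover have "{v. alive \<xi> \<kappa> ?Y t \<omega> v} = (\<Union>n. ?A n)"
    by auto
  then have "num_alive \<xi> \<kappa> ?Y t \<omega> = (\<Sum>n. emeasure (count_space UNIV) (?A n))"
    unfolding num_alive_def
    by (subst suminf_emeasure) (auto simp: disjoint_family_on_def)
  ultimately show ?thesis
    by simp
qed

context branching_model
begin

text \<open>Each line of descent meets every generation once, in order, so along it the parameters
  are the process \<open>X\<close> itself.\<close>

lemma generation_parameters: "branching_model P P E \<xi> \<kappa> X (\<lambda>v. X (length v))"
proof (intro branching_model.intro branching_model_axioms.intro)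
  fix l assume "line_of_descent l"
  then have "length (l n) = n" for n
    using line_of_descent_nth by blast
  then show "distr P (\<Pi>\<^sub>M n\<in>UNIV. E) (\<lambda>\<omega> n. X (length (l n)) \<omega>) =
      distr P (\<Pi>\<^sub>M n\<in>UNIV. E) (\<lambda>\<omega> n. X n \<omega>)"
    by simp
qed (simp_all add: P.prob_space_axioms lifetime_measurable lifetime_nonneg offspring_measurable
    offspring_ge_2 process_measurable)

lemma alive_sets_path:
  "{x \<in> space (\<Pi>\<^sub>M n\<in>UNIV. E). alive \<xi> \<kappa> (\<lambda>w x. x (length w)) t x v} \<in> sets (\<Pi>\<^sub>M n\<in>UNIV. E)"
proof -
  note [measurable] = lifetime_measurable offspring_measurable
  show ?thesis
    unfolding alive_def occurs_def by measurable
qed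

text \<open>Being alive is an event of the parameter path along any line through \<open>v\<close>,
  and \<open>line_law\<close> gives that path the law of \<open>X\<close>.\<close>

lemma alive_law:
  assumes "v \<in> labels"
  shows "{\<omega> \<in> space M. alive \<xi> \<kappa> Y t \<omega> v} \<in> sets M"
    and "emeasure M {\<omega> \<in> space M. alive \<xi> \<kappa> Y t \<omega> v} =
      emeasure (distr P (\<Pi>\<^sub>M n\<in>UNIV. E) (\<lambda>\<omega> n. X n \<omega>))
        {x \<in> space (\<Pi>\<^sub>M n\<in>UNIV. E). alive \<xi> \<kappa> (\<lambda>w x. x (length w)) t x v}"
proof -
  obtain l where l: "line_of_descent l" and lv: "\<And>i. i \<le> length v \<Longrightarrow> l i = take i v"
    using line_of_descent_through[OF assms] by blast
  let ?A = "{x \<in> space (\<Pi>\<^sub>M n\<in>UNIV. E). alive \<xi> \<kappa> (\<lambda>w x. x (length w)) t x v}"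
  let ?f = "\<lambda>\<omega> n. Y (l n) \<omega>"
  have "l n \<in> labels" for n
    using line_of_descent_nth[OF l] by blast
  then have f: "?f \<in> measurable M (\<Pi>\<^sub>M n\<in>UNIV. E)"
    by (intro measurable_PiM_single') (auto intro: parameter_measurable
        dest: measurable_space[OF parameter_measurable])
  have "alive \<xi> \<kappa> Y t \<omega> v \<longleftrightarrow> alive \<xi> \<kappa> (\<lambda>w x. x (length w)) t (?f \<omega>) v" for \<omega>
    by (rule alive_cong) (simp add: lv)
  then have eq: "{\<omega> \<in> space M. alive \<xi> \<kappa> Y t \<omega> v} = ?f -` ?A \<inter> space M"
    using measurable_space[OF f] by auto
  show "{\<omega> \<in> space M. alive \<xi> \<kappa> Y t \<omega> v} \<in> sets M"
    unfolding eq by (rule measurable_sets[OF f alive_sets_path])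
  show "emeasure M {\<omega> \<in> space M. alive \<xi> \<kappa> Y t \<omega> v} =
      emeasure (distr P (\<Pi>\<^sub>M n\<in>UNIV. E) (\<lambda>\<omega> n. X n \<omega>)) ?A"
    unfolding eq line_law[OF l, symmetric] by (rule emeasure_distr[OF f alive_sets_path, symmetric])
qed

text \<open>Tonelli over the countable set of labels. The point is that the right-hand side involves
  neither \<open>Y\<close> nor \<open>M\<close>.\<close>

lemma nn_integral_num_alive:
  "(\<integral>\<^sup>+\<omega>. num_alive \<xi> \<kappa> Y t \<omega> \<partial>M) =
    (\<integral>\<^sup>+v. emeasure (distr P (\<Pi>\<^sub>M n\<in>UNIV. E) (\<lambda>\<omega> n. X n \<omega>))
      {x \<in> space (\<Pi>\<^sub>M n\<in>UNIV. E). alive \<xi> \<kappa> (\<lambda>w x. x (length w)) t x v} \<partial>count_space labels)"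
proof -
  have "num_alive \<xi> \<kappa> Y t \<omega> =
      (\<integral>\<^sup>+v. indicator {\<omega> \<in> space M. alive \<xi> \<kappa> Y t \<omega> v} \<omega> \<partial>count_space labels)"
    if "\<omega> \<in> space M" for \<omega>
  proof -
    \<comment> \<open>Counting within \<open>labels\<close> loses no cell and keeps to the range
      where \<open>alive_law\<close> applies.\<close>
    have sub: "{v. alive \<xi> \<kappa> Y t \<omega> v} \<subseteq> labels"
      by (auto simp: alive_def)
    have "num_alive \<xi> \<kappa> Y t \<omega> = emeasure (count_space labels) {v. alive \<xi> \<kappa> Y t \<omega> v}"
      using sub by (simp add: num_alive_def emeasure_count_space)
    also have "\<dots> = (\<integral>\<^sup>+v. indicator {v. alive \<xi> \<kappa> Y t \<omega> v} v \<partial>count_space labels)"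
      using sub by (intro nn_integral_indicator[symmetric]) simp
    finally show ?thesis
      using that by (simp add: indicator_def)
  qed
  then have "(\<integral>\<^sup>+\<omega>. num_alive \<xi> \<kappa> Y t \<omega> \<partial>M) =
      (\<integral>\<^sup>+\<omega>. \<integral>\<^sup>+v. indicator {\<omega> \<in> space M. alive \<xi> \<kappa> Y t \<omega> v} \<omega> \<partial>count_space labels \<partial>M)"
    by (intro nn_integral_cong)
  also have "\<dots> =
      (\<integral>\<^sup>+v. \<integral>\<^sup>+\<omega>. indicator {\<omega> \<in> space M. alive \<xi> \<kappa> Y t \<omega> v} \<omega> \<partial>M \<partial>count_space labels)"
    by (intro nn_integral_count_space_nn_integral borel_measurable_indicator alive_law) simp_all
  also have "\<dots> = (\<integral>\<^sup>+v. emeasure M {\<omega> \<in> space M. alive \<xi> \<kappa> Y t \<omega> v} \<partial>count_space labels)"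
    by (intro nn_integral_cong nn_integral_indicator alive_law(1)) simp
  also have "\<dots> = (\<integral>\<^sup>+v. emeasure (distr P (\<Pi>\<^sub>M n\<in>UNIV. E) (\<lambda>\<omega> n. X n \<omega>))
      {x \<in> space (\<Pi>\<^sub>M n\<in>UNIV. E). alive \<xi> \<kappa> (\<lambda>w x. x (length w)) t x v} \<partial>count_space labels)"
    by (intro nn_integral_cong alive_law(2)) simp
  finally show ?thesis .
qed

lemma nn_integral_num_alive_generation_parameters:
  "(\<integral>\<^sup>+\<omega>. num_alive \<xi> \<kappa> Y t \<omega> \<partial>M) =
    (\<integral>\<^sup>+\<omega>. num_alive \<xi> \<kappa> (\<lambda>v. X (length v)) t \<omega> \<partial>P)"
  unfolding nn_integral_num_alive
    branching_model.nn_integral_num_alive[OF generation_parameters] ..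

end

theorem proposition2p1:
  fixes P :: "'p measure" and M :: "'w measure" and E :: "'x measure"
    and \<xi> :: "'x \<Rightarrow> real" and \<kappa> :: "'x \<Rightarrow> nat"
    and X :: "nat \<Rightarrow> 'p \<Rightarrow> 'x" and Y :: "nat list \<Rightarrow> 'w \<Rightarrow> 'x"
    and t :: real
  assumes "branching_model P M E \<xi> \<kappa> X Y"
    and "t > 0"
    and "(\<Sum>n. \<integral>\<^sup>+\<omega>. of_nat (\<Prod>j\<le>n. \<kappa> (X j \<omega>)) * indicator {\<omega>. partial_sum \<xi> X n \<omega> \<le> t} \<omega> \<partial>P)
           < (\<infinity> :: ennreal)"
  shows "(\<integral>\<^sup>+\<omega>. num_alive \<xi> \<kappa> Y t \<omega> \<partial>M) < \<infinity> \<and>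
    (\<integral>\<^sup>+\<omega>. num_alive \<xi> \<kappa> Y t \<omega> \<partial>M) =
      1 + (\<Sum>n. \<integral>\<^sup>+\<omega>. of_nat ((\<Prod>j<n. \<kappa> (X j \<omega>)) * (\<kappa> (X n \<omega>) - 1))
                         * indicator {\<omega>. partial_sum \<xi> X n \<omega> \<le> t} \<omega> \<partial>P)"
proof -
  interpret branching_model P M E \<xi> \<kappa> X Y by fact
  note [measurable] = lifetime_measurable offspring_measurable process_measurable
  let ?S = "partial_sum \<xi> X"
  \<comment> \<open>In the model with shared parameters, these are expected numbers for generation
    \<open>n\<close> at time \<open>t\<close>: \<open>a\<close> counts cells already born,
    \<open>b\<close> those already split, \<open>c\<close> those alive, and \<open>d\<close> the net
    gain in cells from the splittings.\<close>
  define a where "a n = (\<integral>\<^sup>+\<omega>. of_nat (\<Prod>j<n. \<kappa> (X j \<omega>)) *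
    indicator {\<omega>. (\<Sum>k<n. \<xi> (X k \<omega>)) \<le> t} \<omega> \<partial>P)" for n
  define b where "b n = (\<integral>\<^sup>+\<omega>. of_nat (\<Prod>j<n. \<kappa> (X j \<omega>)) * indicator {\<omega>. ?S n \<omega> \<le> t} \<omega> \<partial>P)" for n
  define c where "c n = (\<integral>\<^sup>+\<omega>. of_nat (\<Prod>j<n. \<kappa> (X j \<omega>)) *
    indicator {\<omega>. (\<Sum>k<n. \<xi> (X k \<omega>)) \<le> t \<and> t < ?S n \<omega>} \<omega> \<partial>P)" for n
  define d where "d n = (\<integral>\<^sup>+\<omega>. of_nat ((\<Prod>j<n. \<kappa> (X j \<omega>)) * (\<kappa> (X n \<omega>) - 1)) *
    indicator {\<omega>. ?S n \<omega> \<le> t} \<omega> \<partial>P)" for n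
  have ind [measurable]:
    "(\<lambda>\<omega>. indicator {\<omega>. ?S n \<omega> \<le> t} \<omega> :: ennreal) \<in> borel_measurable P"
    "(\<lambda>\<omega>. indicator {\<omega>. (\<Sum>k<n. \<xi> (X k \<omega>)) \<le> t} \<omega> :: ennreal) \<in> borel_measurable P"
    "(\<lambda>\<omega>. indicator {\<omega>. (\<Sum>k<n. \<xi> (X k \<omega>)) \<le> t \<and> t < ?S n \<omega>} \<omega> :: ennreal)
      \<in> borel_measurable P" for n
    unfolding indicator_def partial_sum_def mem_Collect_eq by measurable
  have prod [measurable]: "(\<lambda>\<omega>. \<Prod>j<n. \<kappa> (X j \<omega>)) \<in> measurable P (count_space UNIV)" for n
    by (induction n) (simp_all, measurable)
  have N: "(\<integral>\<^sup>+\<omega>. num_alive \<xi> \<kappa> Y t \<omega> \<partial>M) = (\<Sum>n. c n)"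
    unfolding nn_integral_num_alive_generation_parameters num_alive_generation_parameters c_def
    by (rule nn_integral_suminf) measurable
  have S: "?S n \<omega> = (\<Sum>k<n. \<xi> (X k \<omega>)) + \<xi> (X n \<omega>)" for n \<omega>
    unfolding partial_sum_def lessThan_Suc_atMost[symmetric] by simp
  \<comment> \<open>A cell already born is either alive or already split. Nonnegative lifetimes
    ensure that a split cell was born by time \<open>t\<close>. Sums replace differences since the
    values lie in \<open>ennreal\<close>.\<close>
  have "c n + b n = a n" for n
  proof -
    have "c n + b n = (\<integral>\<^sup>+\<omega>. of_nat (\<Prod>j<n. \<kappa> (X j \<omega>)) *
        indicator {\<omega>. (\<Sum>k<n. \<xi> (X k \<omega>)) \<le> t \<and> t < ?S n \<omega>} \<omega> +
        of_nat (\<Prod>j<n. \<kappa> (X j \<omega>)) * indicator {\<omega>. ?S n \<omega> \<le> t} \<omega> \<partial>P)"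
      unfolding c_def b_def by (rule nn_integral_add[symmetric]) measurable
    also have "\<dots> = a n"
      unfolding a_def
    proof (rule nn_integral_cong)
      fix \<omega> assume "\<omega> \<in> space P"
      then have "0 \<le> \<xi> (X n \<omega>)"
        using lifetime_nonneg measurable_space[OF process_measurable] by blast
      then show "of_nat (\<Prod>j<n. \<kappa> (X j \<omega>)) *
          indicator {\<omega>. (\<Sum>k<n. \<xi> (X k \<omega>)) \<le> t \<and> t < ?S n \<omega>} \<omega> +
          of_nat (\<Prod>j<n. \<kappa> (X j \<omega>)) * indicator {\<omega>. ?S n \<omega> \<le> t} \<omega> =
          (of_nat (\<Prod>j<n. \<kappa> (X j \<omega>)) * indicator {\<omega>. (\<Sum>k<n. \<xi> (X k \<omega>)) \<le> t} \<omega> :: ennreal)"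
        by (auto simp: S indicator_def simp del: of_nat_prod)
    qed
    finally show ?thesis .
  qed
  then have cb: "(\<Sum>n. c n) + (\<Sum>n. b n) = (\<Sum>n. a n)"
    by (simp add: suminf_add summableI)
  \<comment> \<open>Adding the split cells back to the net gain counts all their children. As
    \<kappa> is at least 2, the natural subtraction \<open>\<kappa> (X n \<omega>) - 1\<close> is
    exact.\<close>
  have "d n + b n = a (Suc n)" for n
  proof -
    have "d n + b n = (\<integral>\<^sup>+\<omega>. of_nat ((\<Prod>j<n. \<kappa> (X j \<omega>)) * (\<kappa> (X n \<omega>) - 1)) *
        indicator {\<omega>. ?S n \<omega> \<le> t} \<omega> +
        of_nat (\<Prod>j<n. \<kappa> (X j \<omega>)) * indicator {\<omega>. ?S n \<omega> \<le> t} \<omega> \<partial>P)"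
      unfolding d_def b_def by (rule nn_integral_add[symmetric]) measurable
    also have "\<dots> = a (Suc n)"
      unfolding a_def
    proof (rule nn_integral_cong)
      fix \<omega> assume "\<omega> \<in> space P"
      then have "2 \<le> \<kappa> (X n \<omega>)"
        using offspring_ge_2 measurable_space[OF process_measurable] by blast
      then have "(\<Prod>j<n. \<kappa> (X j \<omega>)) * (\<kappa> (X n \<omega>) - 1) + (\<Prod>j<n. \<kappa> (X j \<omega>)) =
          (\<Prod>j<Suc n. \<kappa> (X j \<omega>))"
        by (simp add: algebra_simps)
      then show "of_nat ((\<Prod>j<n. \<kappa> (X j \<omega>)) * (\<kappa> (X n \<omega>) - 1)) * indicator {\<omega>. ?S n \<omega> \<le> t} \<omega> +
          of_nat (\<Prod>j<n. \<kappa> (X j \<omega>)) * indicator {\<omega>. ?S n \<omega> \<le> t} \<omega> =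
          (of_nat (\<Prod>j<Suc n. \<kappa> (X j \<omega>)) *
            indicator {\<omega>. (\<Sum>k<Suc n. \<xi> (X k \<omega>)) \<le> t} \<omega> :: ennreal)"
        unfolding distrib_right[symmetric] of_nat_add[symmetric]
        by (simp add: S indicator_def del: of_nat_prod of_nat_mult of_nat_add)
    qed
    finally show ?thesis .
  qed
  then have db: "(\<Sum>n. d n) + (\<Sum>n. b n) = (\<Sum>n. a (Suc n))"
    by (simp add: suminf_add summableI)
  \<comment> \<open>The series assumed finite is thus that of \<open>a\<close> without its term at
    0.\<close>
  have a_Suc: "a (Suc n) = (\<integral>\<^sup>+\<omega>. of_nat (\<Prod>j\<le>n. \<kappa> (X j \<omega>)) *
      indicator {\<omega>. ?S n \<omega> \<le> t} \<omega> \<partial>P)" for n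
    by (simp only: a_def partial_sum_def lessThan_Suc_atMost)
  have fin: "(\<Sum>n. a (Suc n)) < \<infinity>"
    using assms(3) by (simp only: a_Suc)
  \<comment> \<open>The initial cell: empty product, and empty sum 0 below \<open>t\<close>. This is
    the 1 in the formula.\<close>
  have "a 0 = 1"
    using \<open>t > 0\<close> by (simp add: a_def P.emeasure_space_1)
  then have a: "(\<Sum>n. a n) = 1 + (\<Sum>n. a (Suc n))"
    using suminf_offset[of a 1] by (simp add: summableI)
  \<comment> \<open>Finiteness is what permits cancelling this sum in \<open>ennreal\<close>
    below.\<close>
  have "(\<Sum>n. b n) < \<infinity>"
    using fin db by (metis ennreal_add_less_top infinity_ennreal_def)
  moreover have "(\<Sum>n. c n) + (\<Sum>n. b n) = (1 + (\<Sum>n. d n)) + (\<Sum>n. b n)"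
    unfolding cb a db[symmetric] by (simp add: add.assoc)
  ultimately have "(\<Sum>n. c n) = 1 + (\<Sum>n. d n)"
    by (metis add.commute ennreal_add_left_cancel infinity_ennreal_def less_irrefl)
  moreover have "(\<Sum>n. c n) < \<infinity>"
    using cb a fin by (metis ennreal_add_less_top ennreal_one_less_top infinity_ennreal_def)
  ultimately show ?thesis
    unfolding N d_def by simp
qed

end
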